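(* Let $A=(a_{ij})_{1\le i,j\le 3}$ be a $3\times 3$ matrix with positive real entries, and let $x$ be the $(1,1)$ entry of $\mathrm{Sink}(A)$. Then $d_6x^6+d_5x^5+d_4x^4+d_3x^3+d_2x^2+d_1x+d_0=0$, where (writing each set of minor specifications as a set of pairs $(R,C)$) \begin{align*} d_6={}&\Sigma(\{(\{\},\{\}),(\{2\},\{2\}),(\{2\},\{3\}),(\{3\},\{2\}),(\{3\},\{3\}),(\{2,3\},\{2,3\})\}),\\ d_5={}&-3\,\Sigma(\{(\{\},\{\}),(\{2\},\{2\}),(\{2\},\{3\}),(\{3\},\{2\}),(\{3\},\{3\})\})\\ &-\Sigma(\{(\{\},\{\}),(\{2\},\{2\}),(\{2\},\{3\}),(\{3\},\{2\}),(\{2,3\},\{2,3\})\})\\ &+\Sigma(\{(\{2\},\{2\}),(\{2\},\{3\}),(\{3\},\{2\}),(\{3\},\{3\}),(\{2,3\},\{2,3\})\}),\\ d_4={}&4\,\Sigma(\{(\{\},\{\}),(\{2\},\{2\}),(\{2\},\{3\}),(\{3\},\{2\})\})+\Sigma(\{(\{\},\{\}),(\{2\},\{2\}),(\{3\},\{3\}),(\{2,3\},\{2,3\})\})\\ &-3\,\Sigma(\{(\{2\},\{2\}),(\{2\},\{3\}),(\{3\},\{2\}),(\{3\},\{3\})\}),\\ d_3={}&-4\,\Sigma(\{(\{\},\{\}),(\{2\},\{2\}),(\{2\},\{3\})\})-5\,\Sigma(\{(\{\},\{\}),(\{2\},\{2\}),(\{3\},\{3\})\})\\ &+\Sigma(\{(\{\},\{\}),(\{2\},\{2\}),(\{2,3\},\{2,3\})\})+\Sigma(\{(\{2\},\{2\}),(\{2\},\{3\}),(\{3\},\{2\})\})\\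 &-\Sigma(\{(\{2\},\{2\}),(\{3\},\{3\}),(\{2,3\},\{2,3\})\}),\\ d_2={}&4\,\Sigma(\{(\{\},\{\}),(\{2\},\{2\})\})-3\,\Sigma(\{(\{\},\{\}),(\{2,3\},\{2,3\})\})+\Sigma(\{(\{2\},\{2\}),(\{3\},\{3\})\}),\\ d_1={}&-3\,\Sigma(\{(\{\},\{\})\})-\Sigma(\{(\{2\},\{2\})\})+\Sigma(\{(\{2,3\},\{2,3\})\}),\\ d_0={}&\Sigma(\{\}). \end{align*}
   Context: Sinkhorn limit: for a square matrix $A$ with positive entries, $\mathrm{Sink}(A)$ is the unique doubly stochastic matrix $S$ such that $S=RAC$ for diagonal matrices $R,C$ with positive diagonal entries (equivalently, the limit of alternately normalizing row sums and column sums to $1$). Notation for a $3\times3$ matrix $A=(a_{ij})$: let $D=D(3,3)$ be the set of all pairs $(R,C)$ with $R,C\subseteq\{2,3\}$ and $|R|=|C|$; explicitly $D=\{(\{\},\{\}),(\{2\},\{2\}),(\{2\},\{3\}),(\{3\},\{2\}),(\{3\},\{3\}),(\{2,3\},\{2,3\})\}$. For $I,J$ sets of indices, $A_{I,J}$ is the submatrix with rows in $I$ and columns in $J$ (the determinant of the $0\times 0$ matrix is $1$). For $(R,C)\in D$ let $\Delta(R,C)=\det A_{\{1\}\cup R,\{1\}\cup C}$ and $\Gamma(R,C)=a_{11}\det A_{R,C}$. For $S\subseteq D$ let \[M(S)=\prod_{(R,C)\in S}\Delta(R,C)\cdot\prod_{(R,C)\in D\setminus S}\Gamma(R,C).\]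 For $S,T\subseteq D$ write $T\equiv S$ if the set of minors specified by $T$ is transformed into the set specified by $S$ by some composition of row permutations of $A$ fixing the first row, column permutations fixing the first column, and transposition (i.e., $T$ is mapped to $S$ by applying to all index sets a permutation of $\{2,3\}$ on the row indices, a permutation of $\{2,3\}$ on the column indices, and possibly swapping each pair $(R,C)\mapsto(C,R)$). The class sum is $\Sigma(S)=\sum_{T\subseteq D,\ T\equiv S}M(T)$. *)

theory Defs
  imports
    "HOL-Combinatorics.Permutations"
    "Jordan_Normal_Form.Determinant"
    "Jordan_Normal_Form.DL_Submatrix"
begin

section \<open>The Sinkhorn limit\<close>

definition doubly_stochastic :: "real mat \<Rightarrow> bool" where
  "doubly_stochastic S \<longleftrightarrow> square_mat S
     \<and> (\<forall>i<dim_row S. \<forall>j<dim_col S. 0 \<le> S $$ (i, j))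
     \<and> (\<forall>i<dim_row S. (\<Sum>j<dim_col S. S $$ (i, j)) = 1)
     \<and> (\<forall>j<dim_col S. (\<Sum>i<dim_row S. S $$ (i, j)) = 1)"

definition positive_diagonal :: "nat \<Rightarrow> real mat \<Rightarrow> bool" where
  "positive_diagonal n R \<longleftrightarrow> R \<in> carrier_mat n n \<and> diagonal_mat R \<and> (\<forall>i<n. 0 < R $$ (i, i))"

text \<open>Meaningful for square matrices with positive entries, where existence and uniqueness
  hold by Sinkhorn's theorem.\<close>

definition Sink :: "real mat \<Rightarrow> real mat" where
  "Sink A = (THE S. doubly_stochastic S \<and>
     (\<exists>R C. positive_diagonal (dim_row A) R \<and> positive_diagonal (dim_row A) C \<and> S = R * A * C))"


section \<open>Minors and class sums of a 3 by 3 matrix\<close>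

text \<open>Index sets are 1-based, as in the usual mathematical notation, whereas the entries
  of a \<^typ>\<open>'a mat\<close> are 0-based; hence the shift by \<^const>\<open>Suc\<close>.\<close>

definition minor :: "real mat \<Rightarrow> nat set \<Rightarrow> nat set \<Rightarrow> real" where
  "minor A I J = det (submatrix A {i. Suc i \<in> I} {j. Suc j \<in> J})"

type_synonym minor_spec = "nat set \<times> nat set"

definition D :: "minor_spec set" where
  "D = {(R, C). R \<subseteq> {2, 3} \<and> C \<subseteq> {2, 3} \<and> card R = card C}"

lemma D_eq: "D = {({}, {}), ({2}, {2}), ({2}, {3}), ({3}, {2}), ({3}, {3}), ({2, 3}, {2, 3})}"
proof -
  have "D = {RC \<in> Pow {2, 3} \<times> Pow {2, 3}. card (fst RC) = card (snd RC)}"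
    by (auto simp: D_def)
  also have "\<dots> = {({}, {}), ({2}, {2}), ({2}, {3}), ({3}, {2}), ({3}, {3}), ({2, 3}, {2, 3})}"
    by (auto simp: Pow_insert)
  finally show ?thesis .
qed

definition \<Delta> :: "real mat \<Rightarrow> minor_spec \<Rightarrow> real" where
  "\<Delta> A = (\<lambda>(R, C). minor A ({1} \<union> R) ({1} \<union> C))"

definition \<Gamma> :: "real mat \<Rightarrow> minor_spec \<Rightarrow> real" where
  "\<Gamma> A = (\<lambda>(R, C). A $$ (0, 0) * minor A R C)"

definition M :: "real mat \<Rightarrow> minor_spec set \<Rightarrow> real" where
  "M A S = (\<Prod>RC\<in>S. \<Delta> A RC) * (\<Prod>RC\<in>D - S. \<Gamma> A RC)"

text \<open>Every composition of row permutations, column permutations and transpositions can be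
  written as a row and a column permutation followed by at most one transposition.\<close>

definition minors_equiv :: "minor_spec set \<Rightarrow> minor_spec set \<Rightarrow> bool" where
  "minors_equiv T S \<longleftrightarrow> (\<exists>p q. p permutes {2, 3} \<and> q permutes {2, 3} \<and>
     (S = (\<lambda>(R, C). (p ` R, q ` C)) ` T \<or> S = prod.swap ` (\<lambda>(R, C). (p ` R, q ` C)) ` T))"

definition class_sum :: "real mat \<Rightarrow> minor_spec set \<Rightarrow> real" where
  "class_sum A S = (\<Sum>T | T \<subseteq> D \<and> minors_equiv T S. M A T)"

end

(* By Brouwer's fixed point theorem, applied to r |-> 1 / (A (1 / (A^T r))) normalised on the simplex,
   a positive matrix can be scaled to a doubly stochastic one, and comparing the largest row factor
   with the column factors shows uniqueness. All M(T) acquire the same factor under A |-> RAC, so A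
   may be replaced by the doubly stochastic matrix S = Sink(A).

   Let w be the block of S with rows and columns 2, 3, and let f = xw - ab be its matrix of minors
   containing the entry x, where a and b are the rest of the first column and row. Then
   h = w - f = (1 - x)w + ab has all row and column sums equal to 1 - x, hence it is of the form
   ((t, s), (s, t)). Expanding the products of entries of f = w - h makes the polynomial collapse
   to a multiple of ts, and what remains is an identity in t, s and the two diagonal sums of w. *)

theory Submission
  imports Defs "HOL-Analysis.Analysis"
begin

section \<open>Sinkhorn's theorem for positive square matrices, then the 3 by 3 case\<close>

section \<open>Existence and uniqueness of the Sinkhorn limit\<close>

no_notation vec_index (infixl "$" 100)

text \<open>For row factors \<open>v\<close>, the column factors \<open>c v\<close> make all columns
  of \<open>v $ i * a i j * c v j\<close> sum to 1, and \<open>\<rho> v\<close> are the row factors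
  that give row sums 1 next to \<open>c v\<close>. At a fixed point of the normalised map
  \<open>f\<close>, \<open>v\<close> is proportional to \<open>\<rho> v\<close>, so all row sums
  agree. The index is a finite type so that the simplex lives in \<open>real ^ 'n\<close>, where
  Brouwer's theorem applies.\<close>

lemma sinkhorn_scaling_exists:
  fixes a :: "'n::finite \<Rightarrow> 'n \<Rightarrow> real"
  assumes pos: "\<And>i j. 0 < a i j"
  shows "\<exists>r c. (\<forall>i. 0 < r i) \<and> (\<forall>j. 0 < c j)
    \<and> (\<forall>i. (\<Sum>j\<in>UNIV. r i * a i j * c j) = 1) \<and> (\<forall>j. (\<Sum>i\<in>UNIV. r i * a i j * c j) = 1)"
proof -
  define S where "S = {v :: real ^ 'n. (\<forall>i. 0 \<le> v $ i) \<and> (\<Sum>i\<in>UNIV. v $ i) = 1}"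
  define c where "c = (\<lambda>(v :: real ^ 'n) j. 1 / (\<Sum>k\<in>UNIV. v $ k * a k j))"
  define \<rho> where "\<rho> = (\<lambda>v i. 1 / (\<Sum>j\<in>UNIV. a i j * c v j))"
  define f where "f = (\<lambda>v. (\<chi> i. \<rho> v i / (\<Sum>k\<in>UNIV. \<rho> v k)) :: real ^ 'n)"
  have col_pos: "0 < (\<Sum>k\<in>UNIV. v $ k * a k j)" if "v \<in> S" for v j
  proof -
    have "\<exists>k. v $ k \<noteq> 0"
    proof (rule ccontr)
      assume "\<nexists>k. v $ k \<noteq> 0"
      then show False using that by (simp add: S_def)
    qed
    then obtain k where "v $ k \<noteq> 0" ..
    with that have "0 < v $ k" by (simp add: S_def order_less_le)
    with pos that show ?thesis
      by (intro sum_pos2[of _ k]) (auto simp: S_def less_imp_le)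
  qed
  have c_pos: "0 < c v j" if "v \<in> S" for v j
    using col_pos[OF that] by (simp add: c_def)
  have row_pos: "0 < (\<Sum>j\<in>UNIV. a i j * c v j)" if "v \<in> S" for v i
    using c_pos[OF that] pos by (intro sum_pos) auto
  have \<rho>_pos: "0 < \<rho> v i" if "v \<in> S" for v i
    using row_pos[OF that] by (simp add: \<rho>_def)
  have total_pos: "0 < (\<Sum>k\<in>UNIV. \<rho> v k)" if "v \<in> S" for v
    using \<rho>_pos[OF that] by (intro sum_pos) auto
  have "closed S"
    unfolding S_def by (intro closed_Collect_conj closed_Collect_all closed_Collect_le closed_Collect_eq continuous_intros)
  moreover have "bounded S"
  proof (rule bounded_subset[OF bounded_cbox[of 0 1]])
    show "S \<subseteq> cbox 0 1"
    proof
      fix v assume "v \<in> S"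
      then have "v $ i \<le> 1" for i
        using member_le_sum[of i UNIV "\<lambda>i. v $ i"] by (auto simp: S_def)
      with \<open>v \<in> S\<close> show "v \<in> cbox 0 1"
        by (simp add: S_def mem_box_cart)
    qed
  qed
  ultimately have "compact S" by (simp add: compact_eq_bounded_closed)
  moreover have "convex S"
    by (rule convexI) (simp add: S_def sum.distrib flip: sum_distrib_left)
  moreover have "(\<chi> i. 1 / real CARD('n)) \<in> S" by (simp add: S_def)
  then have "S \<noteq> {}" by blast
  moreover have "continuous_on S f"
  proof -
    have "continuous_on S (\<lambda>v. c v j)" for j
      unfolding c_def
      by (intro continuous_intros ballI) (erule less_imp_neq[OF col_pos, symmetric])
    then have "continuous_on S (\<lambda>v. \<rho> v i)" for i
      unfolding \<rho>_def
      by (intro continuous_intros ballI) (auto dest: row_pos[of _ i])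
    then show ?thesis
      unfolding f_def
      by (intro continuous_intros ballI) (auto dest: total_pos)
  qed
  moreover have "f \<in> S \<rightarrow> S"
  proof
    fix v assume v: "v \<in> S"
    have "0 \<le> f v $ i" for i
      using \<rho>_pos[OF v, of i] total_pos[OF v] by (simp add: f_def)
    moreover have "(\<Sum>i\<in>UNIV. f v $ i) = 1"
      using total_pos[OF v] by (simp add: f_def flip: sum_divide_distrib)
    ultimately show "f v \<in> S" by (simp add: S_def)
  qed
  ultimately obtain v where v: "v \<in> S" "f v = v"
    by (rule brouwer)
  define \<mu> where "\<mu> = 1 / (\<Sum>k\<in>UNIV. \<rho> v k)"
  have v_eq: "v $ i = \<mu> * \<rho> v i" for i
    using arg_cong[OF v(2), of "\<lambda>v. v $ i"] by (simp add: f_def \<mu>_def)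
  have v_pos: "0 < v $ i" for i
    using v_eq \<rho>_pos[OF v(1)] total_pos[OF v(1)] by (simp add: \<mu>_def)
  have col: "(\<Sum>i\<in>UNIV. v $ i * a i j * c v j) = 1" for j
    using col_pos[OF v(1), of j] by (simp add: c_def flip: sum_distrib_right sum_divide_distrib)
  have row: "(\<Sum>j\<in>UNIV. v $ i * a i j * c v j) = \<mu>" for i
  proof -
    have "(\<Sum>j\<in>UNIV. v $ i * a i j * c v j) = v $ i * (\<Sum>j\<in>UNIV. a i j * c v j)"
      by (simp add: sum_distrib_left mult.assoc)
    then show ?thesis
      using row_pos[OF v(1), of i] by (simp add: v_eq \<rho>_def)
  qed
  \<comment> \<open>Double counting of the total: all column sums are 1, all row sums are
    \<open>\<mu>\<close>, and there are as many rows as columns.\<close>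
  have "real CARD('n) = (\<Sum>j\<in>UNIV. \<Sum>i\<in>UNIV. v $ i * a i j * c v j)"
    by (simp add: col)
  also have "\<dots> = (\<Sum>i\<in>UNIV. \<Sum>j\<in>UNIV. v $ i * a i j * c v j)"
    by (rule sum.swap)
  also have "\<dots> = real CARD('n) * \<mu>" by (simp add: row)
  finally have "\<mu> = 1" by simp
  with row col v_pos c_pos[OF v(1)] show ?thesis by blast
qed

text \<open>A maximum principle: bounding every row factor by the largest one, \<open>m\<close>, in
  a column sum gives \<open>1 \<le> m * c l\<close>. The row where \<open>m\<close> is attained
  forces equality for every \<open>l\<close>, and then every row factor equals
  \<open>m\<close>.\<close>

lemma doubly_stochastic_scaling_unique:
  fixes s :: "'n \<Rightarrow> 'n \<Rightarrow> real"
  assumes I: "finite I"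
    and pos: "\<And>i j. i \<in> I \<Longrightarrow> j \<in> I \<Longrightarrow> 0 < s i j"
    and r: "\<And>i. i \<in> I \<Longrightarrow> 0 < r i" and c: "\<And>j. j \<in> I \<Longrightarrow> 0 < c j"
    and row: "\<And>i. i \<in> I \<Longrightarrow> (\<Sum>j\<in>I. s i j) = 1"
    and col: "\<And>j. j \<in> I \<Longrightarrow> (\<Sum>i\<in>I. s i j) = 1"
    and row': "\<And>i. i \<in> I \<Longrightarrow> (\<Sum>j\<in>I. r i * s i j * c j) = 1"
    and col': "\<And>j. j \<in> I \<Longrightarrow> (\<Sum>i\<in>I. r i * s i j * c j) = 1"
    and ij: "i \<in> I" "j \<in> I"
  shows "r i * c j = 1"
proof -
  define m where "m = Max (r ` I)"
  have "m \<in> r ` I" unfolding m_def using I ij by (intro Max_in) auto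
  then obtain k where k: "k \<in> I" "r k = m" by auto
  have m: "0 < m" using r k by blast
  have r_le: "r l \<le> m" if "l \<in> I" for l
    using that I by (simp add: m_def)
  have mc: "1 \<le> m * c l" if l: "l \<in> I" for l
  proof -
    have "1 = (\<Sum>i\<in>I. r i * (s i l * c l))" using col'[OF l] by (simp add: mult.assoc)
    also have "\<dots> \<le> (\<Sum>i\<in>I. m * (s i l * c l))"
      using r_le pos c l by (intro sum_mono mult_right_mono) (auto simp: less_imp_le)
    also have "\<dots> = m * ((\<Sum>i\<in>I. s i l) * c l)" by (simp add: sum_distrib_left sum_distrib_right)
    also have "\<dots> = m * c l" using col[OF l] by simp
    finally show ?thesis .
  qed
  \<comment> \<open>Row \<open>k\<close> sums to 1 before and after scaling. The difference of the
    two sums has only nonnegative terms, so each term vanishes.\<close>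
  have "(\<Sum>l\<in>I. s k l * (m * c l - 1)) = 0"
    using row'[OF k(1)] row[OF k(1)] k(2) by (simp add: algebra_simps sum_subtractf)
  moreover have "0 \<le> s k l * (m * c l - 1)" if "l \<in> I" for l
    using pos[OF k(1) that] mc[OF that] by simp
  ultimately have "\<forall>l\<in>I. s k l * (m * c l - 1) = 0"
    using I by (simp add: sum_nonneg_eq_0_iff)
  then have c_eq: "m * c l = 1" if "l \<in> I" for l
    using pos[OF k(1) that] that by force
  have "(\<Sum>j\<in>I. r i * s i j * c j) * m = (\<Sum>j\<in>I. r i * s i j * (m * c j))"
    by (simp add: sum_distrib_right sum_distrib_left mult_ac)
  also have "\<dots> = r i * (\<Sum>j\<in>I. s i j)" by (simp add: c_eq sum_distrib_left)
  finally have "r i = m" using row'[OF ij(1)] row[OF ij(1)] by simp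
  with c_eq ij show ?thesis by simp
qed

lemma positive_diagonal_mat_diag:
  "positive_diagonal n R \<longleftrightarrow> (\<exists>r. R = mat_diag n r \<and> (\<forall>i<n. 0 < r i))"
proof
  assume R: "positive_diagonal n R"
  then have "R = mat_diag n (\<lambda>i. R $$ (i, i))"
    by (intro eq_matI) (auto simp: positive_diagonal_def diagonal_mat_def mat_diag_def)
  with R show "\<exists>r. R = mat_diag n r \<and> (\<forall>i<n. 0 < r i)"
    unfolding positive_diagonal_def by blast
qed (auto simp: positive_diagonal_def diagonal_mat_def mat_diag_def)

lemma mat_diag_mult_both:
  assumes "A \<in> carrier_mat n n"
  shows "mat_diag n r * A * mat_diag n c = Matrix.mat n n (\<lambda>(i, j). r i * A $$ (i, j) * (c j :: 'a :: semiring_1))"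
  using assms by (subst mat_diag_mult_left mat_diag_mult_right[of _ n]; auto)+

lemma doubly_stochastic_mat:
  "doubly_stochastic (Matrix.mat n n f) \<longleftrightarrow> (\<forall>i<n. \<forall>j<n. 0 \<le> f (i, j))
    \<and> (\<forall>i<n. (\<Sum>j<n. f (i, j)) = 1) \<and> (\<forall>j<n. (\<Sum>i<n. f (i, j)) = 1)"
  by (auto simp: doubly_stochastic_def)

text \<open>Resolves the definite description: any positive scaling with a doubly stochastic result
  computes \<open>Sink A\<close>.\<close>

lemma Sink_eq:
  assumes A: "A \<in> carrier_mat n n" "\<And>i j. i < n \<Longrightarrow> j < n \<Longrightarrow> 0 < A $$ (i, j)"
    and r: "\<And>i. i < n \<Longrightarrow> 0 < r i" and c: "\<And>j. j < n \<Longrightarrow> 0 < c j"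
    and S: "S = Matrix.mat n n (\<lambda>(i, j). r i * A $$ (i, j) * c j)" "doubly_stochastic S"
  shows "Sink A = S"
  unfolding Sink_def
proof (rule the_equality)
  have "S = mat_diag n r * A * mat_diag n c"
    unfolding S mat_diag_mult_both[OF A(1)] ..
  then show "doubly_stochastic S \<and> (\<exists>R C. positive_diagonal (dim_row A) R \<and> positive_diagonal (dim_row A) C \<and> S = R * A * C)"
    using A(1) r c S(2) positive_diagonal_mat_diag by auto
next
  fix S'
  assume S': "doubly_stochastic S' \<and> (\<exists>R C. positive_diagonal (dim_row A) R \<and> positive_diagonal (dim_row A) C \<and> S' = R * A * C)"
  then obtain r' c' where r': "\<And>i. i < n \<Longrightarrow> 0 < r' i" and c': "\<And>j. j < n \<Longrightarrow> 0 < c' j"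
    and "S' = mat_diag n r' * A * mat_diag n c'"
    using A(1) by (auto simp: positive_diagonal_mat_diag)
  then have S'_eq: "S' = Matrix.mat n n (\<lambda>(i, j). r' i * A $$ (i, j) * c' j)"
    by (simp only: mat_diag_mult_both[OF A(1)])
  \<comment> \<open>The competitor \<open>S'\<close> is itself a scaling of \<open>S\<close>, with
    the quotients of the factors, so uniqueness can be applied to the doubly stochastic matrix
    \<open>S\<close>.\<close>
  have ratio: "r' i / r i * (r i * A $$ (i, j) * c j) * (c' j / c j) = r' i * A $$ (i, j) * c' j"
    if "i < n" "j < n" for i j
    using r[OF that(1)] c[OF that(2)] by (simp add: field_simps)
  have "r' i / r i * (c' j / c j) = 1" if "i < n" "j < n" for i j
  proof (rule doubly_stochastic_scaling_unique[where I = "{..<n}" and s = "\<lambda>i j. r i * A $$ (i, j) * c j"])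
    show "(\<Sum>j<n. r' i / r i * (r i * A $$ (i, j) * c j) * (c' j / c j)) = 1" if "i \<in> {..<n}" for i
    proof -
      have "(\<Sum>j<n. r' i / r i * (r i * A $$ (i, j) * c j) * (c' j / c j)) = (\<Sum>j<n. r' i * A $$ (i, j) * c' j)"
        using that by (intro sum.cong ratio) auto
      then show ?thesis using S' that by (simp add: S'_eq doubly_stochastic_mat)
    qed
    show "(\<Sum>i<n. r' i / r i * (r i * A $$ (i, j) * c j) * (c' j / c j)) = 1" if "j \<in> {..<n}" for j
    proof -
      have "(\<Sum>i<n. r' i / r i * (r i * A $$ (i, j) * c j) * (c' j / c j)) = (\<Sum>i<n. r' i * A $$ (i, j) * c' j)"
        using that by (intro sum.cong ratio) auto
      then show ?thesis using S' that by (simp add: S'_eq doubly_stochastic_mat)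
    qed
  qed (use S(2) that r c r' c' A(2) in \<open>auto simp: S(1) doubly_stochastic_mat\<close>)
  then have "r' i * A $$ (i, j) * c' j = r i * A $$ (i, j) * c j" if "i < n" "j < n" for i j
    using that r[OF that(1)] c[OF that(2)] by (simp add: field_simps)
  then show "S' = S" unfolding S'_eq S(1) by (intro eq_matI) auto
qed

text \<open>Existence is stated over a finite type, so the numeral type \<open>3\<close> is matched
  with the indices \<open>{..<3}\<close> by a bijection \<open>h\<close> with inverse
  \<open>g\<close>, and the sums are reindexed along \<open>g\<close>.\<close>

lemma Sink_3_scaling:
  assumes A: "A \<in> carrier_mat 3 3" "\<And>i j. i < 3 \<Longrightarrow> j < 3 \<Longrightarrow> 0 < A $$ (i, j)"
  obtains r c where "\<And>i. i < 3 \<Longrightarrow> 0 < r i" "\<And>j. j < 3 \<Longrightarrow> 0 < c j"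
    "Sink A = Matrix.mat 3 3 (\<lambda>(i, j). r i * A $$ (i, j) * c j)" "doubly_stochastic (Sink A)"
proof -
  have "card (UNIV :: 3 set) = card {..<3::nat}" by simp
  then obtain h :: "3 \<Rightarrow> nat" where h: "bij_betw h UNIV {..<3}"
    using finite_same_card_bij[of "UNIV :: 3 set" "{..<3::nat}"] by auto
  define g where "g = the_inv_into UNIV h"
  have g: "bij_betw g {..<3} UNIV" unfolding g_def by (rule bij_betw_the_inv_into[OF h])
  have hg: "h (g i) = i" if "i < 3" for i
    unfolding g_def using h that by (intro f_the_inv_into_f_bij_betw) auto
  have "0 < A $$ (h i, h j)" for i j
    using bij_betwE[OF h] A(2) by auto
  then obtain r c where rc: "\<And>i. 0 < r i" "\<And>j. 0 < c j"
    and row: "\<And>i. (\<Sum>j\<in>UNIV. r i * A $$ (h i, h j) * c j) = 1"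
    and col: "\<And>j. (\<Sum>i\<in>UNIV. r i * A $$ (h i, h j) * c j) = 1"
    using sinkhorn_scaling_exists[of "\<lambda>i j. A $$ (h i, h j)"] by blast
  define S where "S = Matrix.mat 3 3 (\<lambda>(i, j). r (g i) * A $$ (i, j) * c (g j))"
  have "(\<Sum>j<3. r (g i) * A $$ (i, j) * c (g j)) = 1" if "i < 3" for i
    using row[of "g i"] sum.reindex_bij_betw[OF g, of "\<lambda>j. r (g i) * A $$ (h (g i), h j) * c j"] that
    by (simp add: hg)
  moreover have "(\<Sum>i<3. r (g i) * A $$ (i, j) * c (g j)) = 1" if "j < 3" for j
    using col[of "g j"] sum.reindex_bij_betw[OF g, of "\<lambda>i. r i * A $$ (h i, h (g j)) * c (g j)"] that
    by (simp add: hg)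
  ultimately have S: "doubly_stochastic S"
    using rc A(2) unfolding S_def doubly_stochastic_mat by (simp add: less_imp_le)
  moreover from this have "Sink A = S"
    using rc A by (intro Sink_eq[where r = "r \<circ> g" and c = "c \<circ> g"]) (auto simp: S_def)
  ultimately show thesis
    using rc by (intro that[of "r \<circ> g" "c \<circ> g"]) (auto simp: S_def)
qed

section \<open>Minors of order at most three as polynomials in the entries\<close>

section \<open>Minors\<close>

lemma pick_singleton [simp]: "pick {a} 0 = a"
  by (simp add: Least_equality)

lemma pick_pair:
  assumes "a < b"
  shows "pick {a, b} 0 = a" "pick {a, b} (Suc 0) = b"
proof -
  show 0: "pick {a, b} 0 = a"
    using assms by (auto intro!: Least_equality)
  show "pick {a, b} (Suc 0) = b"
    using assms unfolding pick.simps(2) 0 by (auto intro!: Least_equality)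
qed

lemma pick_lessThan: "k < n \<Longrightarrow> pick {..<n} k = k"
  using pick_reduce_set[of k n UNIV] by (simp add: pick_UNIV lessThan_def)

lemma det_2: "Determinant.det (Matrix.mat 2 2 f) = f (0, 0) * f (1, 1) - f (0, 1) * (f (1, 0) :: 'a :: comm_ring_1)"
  by (subst laplace_expansion_row[of _ 2 0])
    (auto simp: cofactor_def mat_delete_def numeral_2_eq_2 det_single)

lemma det_3: "Determinant.det (Matrix.mat 3 3 f) = f (0, 0) * (f (1, 1) * f (2, 2) - f (1, 2) * f (2, 1))
  - f (0, 1) * (f (1, 0) * f (2, 2) - f (1, 2) * f (2, 0))
  + f (0, 2) * (f (1, 0) * f (2, 1) - f (1, 1) * (f (2, 0) :: 'a :: comm_ring_1))"
  by (subst laplace_expansion_row[of _ 3 0])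
    (auto simp: cofactor_def mat_delete_def numeral_3_eq_3 det_2[unfolded numeral_2_eq_2],
      simp add: numeral_2_eq_2 algebra_simps)

text \<open>Writing the index sets as images under \<open>Suc\<close> undoes the 1-based shift in
  \<open>minor\<close>; \<open>I\<close> and \<open>J\<close> are then 0-based sets as
  \<open>submatrix\<close> expects.\<close>

lemma minor_image_Suc:
  assumes "A \<in> carrier_mat n n" "I \<subseteq> {..<n}" "J \<subseteq> {..<n}"
  shows "minor A (Suc ` I) (Suc ` J)
    = Determinant.det (Matrix.mat (card I) (card J) (\<lambda>(i, j). A $$ (pick I i, pick J j)))"
proof -
  have "{i. i < dim_row A \<and> i \<in> I} = I" "{j. j < dim_col A \<and> j \<in> J} = J"
    using assms by auto
  then show ?thesis by (simp add: minor_def submatrix_def image_iff)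
qed

lemma minor_formulas:
  assumes "A \<in> carrier_mat 3 3"
  shows "minor A {} {} = 1"
    "i \<in> {1, 2, 3} \<Longrightarrow> j \<in> {1, 2, 3} \<Longrightarrow> minor A {i} {j} = A $$ (i - 1, j - 1)"
    "\<lbrakk>i \<in> {1, 2, 3}; i' \<in> {1, 2, 3}; j \<in> {1, 2, 3}; j' \<in> {1, 2, 3}; i < i'; j < j'\<rbrakk> \<Longrightarrow> minor A {i, i'} {j, j'}
      = A $$ (i - 1, j - 1) * A $$ (i' - 1, j' - 1) - A $$ (i - 1, j' - 1) * A $$ (i' - 1, j - 1)"
    "minor A {1, 2, 3} {1, 2, 3}
      = A $$ (0, 0) * (A $$ (1, 1) * A $$ (2, 2) - A $$ (1, 2) * A $$ (2, 1))
      - A $$ (0, 1) * (A $$ (1, 0) * A $$ (2, 2) - A $$ (1, 2) * A $$ (2, 0))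
      + A $$ (0, 2) * (A $$ (1, 0) * A $$ (2, 1) - A $$ (1, 1) * A $$ (2, 0))"
proof -
  show "minor A {} {} = 1"
    using minor_image_Suc[OF assms, of "{}" "{}"] by simp
  show "minor A {i} {j} = A $$ (i - 1, j - 1)" if "i \<in> {1, 2, 3}" "j \<in> {1, 2, 3}"
  proof -
    define k l where "k = i - 1" and "l = j - 1"
    have kl: "i = Suc k" "j = Suc l" "k < 3" "l < 3" using that by (auto simp: k_def l_def)
    then show ?thesis
      using minor_image_Suc[OF assms, of "{k}" "{l}"] by (simp add: det_single del: pick.simps)
  qed
  show "minor A {i, i'} {j, j'} = A $$ (i - 1, j - 1) * A $$ (i' - 1, j' - 1) - A $$ (i - 1, j' - 1) * A $$ (i' - 1, j - 1)"
    if ij: "i \<in> {1, 2, 3}" "i' \<in> {1, 2, 3}" "j \<in> {1, 2, 3}" "j' \<in> {1, 2, 3}" and less: "i < i'" "j < j'"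
  proof -
    define k l k' l' where "k = i - 1" and "l = j - 1" and "k' = i' - 1" and "l' = j' - 1"
    have kl: "i = Suc k" "j = Suc l" "k < 3" "l < 3" "i' = Suc k'" "j' = Suc l'" "k' < 3" "l' < 3"
      using ij by (auto simp: k_def l_def k'_def l'_def)
    have kl': "k < k'" "l < l'" using less kl by simp_all
    have "minor A {i, i'} {j, j'} = Determinant.det (Matrix.mat 2 2 (\<lambda>(i, j). A $$ (pick {k, k'} i, pick {l, l'} j)))"
      using minor_image_Suc[OF assms, of "{k, k'}" "{l, l'}"] kl kl' by (simp add: numeral_2_eq_2 del: pick.simps)
    then show ?thesis using kl
      by (simp add: det_2 pick_pair[OF kl'(1)] pick_pair[OF kl'(2)] del: pick.simps)
  qed
  have "Suc ` {..<3} = {1, 2, 3}" by (auto simp: image_iff less_Suc_eq eval_nat_numeral)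
  then have "minor A {1, 2, 3} {1, 2, 3} = Determinant.det (Matrix.mat 3 3 (\<lambda>(i, j). A $$ (pick {..<3} i, pick {..<3} j)))"
    using minor_image_Suc[OF assms, of "{..<3}" "{..<3}"] by simp
  then show "minor A {1, 2, 3} {1, 2, 3}
      = A $$ (0, 0) * (A $$ (1, 1) * A $$ (2, 2) - A $$ (1, 2) * A $$ (2, 1))
      - A $$ (0, 1) * (A $$ (1, 0) * A $$ (2, 2) - A $$ (1, 2) * A $$ (2, 0))
      + A $$ (0, 2) * (A $$ (1, 0) * A $$ (2, 1) - A $$ (1, 1) * A $$ (2, 0))"
    unfolding det_3 split by (simp add: pick_lessThan del: pick.simps)
qed

text \<open>At \<open>({}, {})\<close> both \<Delta> and \<Gamma> equal the corner entry, so
  \<open>M A T\<close> takes the same value whether or not \<open>T\<close> contains this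
  pair.\<close>

lemma \<Delta>_\<Gamma>_values:
  assumes "A \<in> carrier_mat 3 3"
  shows "\<Delta> A ({}, {}) = A $$ (0, 0)" "\<Gamma> A ({}, {}) = A $$ (0, 0)"
    "i \<in> {2, 3} \<Longrightarrow> j \<in> {2, 3} \<Longrightarrow> \<Delta> A ({i}, {j})
      = A $$ (0, 0) * A $$ (i - 1, j - 1) - A $$ (i - 1, 0) * A $$ (0, j - 1)"
    "i \<in> {2, 3} \<Longrightarrow> j \<in> {2, 3} \<Longrightarrow> \<Gamma> A ({i}, {j}) = A $$ (0, 0) * A $$ (i - 1, j - 1)"
    "\<Delta> A ({2, 3}, {2, 3})
      = A $$ (0, 0) * (A $$ (1, 1) * A $$ (2, 2) - A $$ (1, 2) * A $$ (2, 1))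
      - A $$ (0, 1) * (A $$ (1, 0) * A $$ (2, 2) - A $$ (1, 2) * A $$ (2, 0))
      + A $$ (0, 2) * (A $$ (1, 0) * A $$ (2, 1) - A $$ (1, 1) * A $$ (2, 0))"
    "\<Gamma> A ({2, 3}, {2, 3}) = A $$ (0, 0) * (A $$ (1, 1) * A $$ (2, 2) - A $$ (1, 2) * A $$ (2, 1))"
  using minor_formulas(1)[OF assms] minor_formulas(2)[OF assms, of 1 1] minor_formulas(2)[OF assms, of i j]
    minor_formulas(3)[OF assms, of 1 i 1 j] minor_formulas(3)[OF assms, of 2 3 2 3] minor_formulas(4)[OF assms]
  by (auto simp: \<Delta>_def \<Gamma>_def)

section \<open>Symmetry orbits of sets of minors and their sums\<close>

section \<open>Class sums\<close>

lemma permutes_pair_iff: "p permutes {a, b} \<longleftrightarrow> p = id \<or> p = Transposition.transpose a b"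
proof
  assume p: "p permutes {a, b}"
  consider "p a = a" | "p a = b" using permutes_in_image[OF p, of a] by auto
  then show "p = id \<or> p = Transposition.transpose a b"
  proof cases
    case 1
    then have "p b = b"
      using permutes_in_image[OF p, of b] permutes_inj[OF p] by (metis inj_eq insert_iff singletonD)
    with 1 have "p x = id x" for x
      using permutes_not_in[OF p, of x] by (cases "x \<in> {a, b}") auto
    then have "p = id" by blast
    then show ?thesis ..
  next
    case 2
    then have "p b = a"
      using permutes_in_image[OF p, of b] permutes_inj[OF p] by (metis inj_eq insert_iff singletonD)
    with 2 have "p x = Transposition.transpose a b x" for x
      using permutes_not_in[OF p, of x] by (cases "x \<in> {a, b}") auto
    then have "p = Transposition.transpose a b" by blast
    then show ?thesis ..
  qed
qed (auto intro: permutes_id permutes_swap_id)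

text \<open>One product over the fixed set \<open>D\<close>, with a choice between \<Delta> and
  \<Gamma> in each factor, allows both rescaling and explicit evaluation factor by factor.\<close>

lemma M_eq: "M A T = (\<Prod>RC\<in>D. if RC \<in> T then \<Delta> A RC else \<Gamma> A RC)" if "T \<subseteq> D"
proof -
  have "finite D" by (simp add: D_eq)
  then have "(\<Prod>RC\<in>D. if RC \<in> T then \<Delta> A RC else \<Gamma> A RC) = prod (\<Delta> A) (D \<inter> T) * prod (\<Gamma> A) (D - T)"
    by (subst prod.If_cases) (simp_all add: Diff_eq)
  with that show ?thesis by (simp add: M_def Int_absorb1)
qed

definition act :: "(nat \<Rightarrow> nat) \<Rightarrow> (nat \<Rightarrow> nat) \<Rightarrow> minor_spec set \<Rightarrow> minor_spec set" where
  "act p q T = (\<lambda>(R, C). (p ` R, q ` C)) ` T"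

abbreviation swap23 :: "nat \<Rightarrow> nat" where
  "swap23 \<equiv> Transposition.transpose 2 3"

lemma act_act:
  assumes "p \<circ> p = id" "q \<circ> q = id"
  shows "act p q (act p q T) = T"
proof -
  have "(\<lambda>(R, C). (p ` R, q ` C)) \<circ> (\<lambda>(R, C). (p ` R, q ` C)) = id"
    by (rule ext) (simp add: case_prod_beta image_comp assms del: image_image)
  then show ?thesis by (simp add: act_def image_comp)
qed

lemma swap23_image [simp]: "swap23 ` {2} = {3}" "swap23 ` {3} = {2}" "swap23 ` {2, 3} = {2, 3}"
  by auto

lemma spec_neq [simp]: "{2, 3} \<noteq> {2 :: nat}" "{2, 3} \<noteq> {3 :: nat}" "{2} \<noteq> {2, 3 :: nat}" "{3} \<noteq> {2, 3 :: nat}"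
  by auto

text \<open>The permutations of \<open>{2, 3}\<close> are \<open>id\<close> and
  \<open>swap23\<close>, and \<open>act p q\<close> and \<open>prod.swap\<close> are involutions.
  Hence the equation for \<open>S\<close> in terms of \<open>T\<close> can be solved for
  \<open>T\<close>, which lists the class of \<open>S\<close> as at most eight explicit
  sets.\<close>

lemma minors_equiv_class:
  "{T. minors_equiv T S} = (\<Union>p\<in>{id, swap23}. \<Union>q\<in>{id, swap23}. {act p q S, act p q (prod.swap ` S)})"
proof -
  have "S = act p q T \<longleftrightarrow> T = act p q S" "S = prod.swap ` act p q T \<longleftrightarrow> T = act p q (prod.swap ` S)"
    if "p \<in> {id, swap23}" "q \<in> {id, swap23}" for p q T
  proof -
    have "p \<circ> p = id" "q \<circ> q = id" using that by auto
    note inv = act_act[OF this]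
    show "S = act p q T \<longleftrightarrow> T = act p q S" using inv by metis
    have "prod.swap ` prod.swap ` U = U" for U :: "minor_spec set"
      by (simp add: image_comp)
    then have "S = prod.swap ` act p q T \<longleftrightarrow> prod.swap ` S = act p q T"
      by metis
    then show "S = prod.swap ` act p q T \<longleftrightarrow> T = act p q (prod.swap ` S)" using inv by metis
  qed
  note eqs = this
  have "minors_equiv T S \<longleftrightarrow> (\<exists>p\<in>{id, swap23}. \<exists>q\<in>{id, swap23}.
      S = act p q T \<or> S = prod.swap ` act p q T)" for T
    unfolding minors_equiv_def permutes_pair_iff act_def by (simp only: Bex_def insert_iff empty_iff simp_thms conj_assoc ex_simps)
  also have "\<dots> T \<longleftrightarrow> (\<exists>p\<in>{id, swap23}. \<exists>q\<in>{id, swap23}.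
      T = act p q S \<or> T = act p q (prod.swap ` S))" for T
    by (intro bex_cong refl) (simp only: eqs)
  finally have mem: "minors_equiv T S \<longleftrightarrow> (\<exists>p\<in>{id, swap23}. \<exists>q\<in>{id, swap23}.
      T = act p q S \<or> T = act p q (prod.swap ` S))" for T .
  show ?thesis
    by (rule Set.set_eqI) (simp only: mem mem_Collect_eq UN_iff insert_iff empty_iff simp_thms)
qed

text \<open>Bijections of \<open>{2, 3}\<close> preserve inclusion in \<open>{2, 3}\<close> and
  cardinality, and the condition defining \<open>D\<close> is symmetric in rows and columns.\<close>

lemma minors_equiv_subset_D:
  assumes "minors_equiv T S" "S \<subseteq> D"
  shows "T \<subseteq> D"
proof -
  obtain p q where pq: "p \<in> {id, swap23}" "q \<in> {id, swap23}"
    and T: "T = act p q S \<or> T = act p q (prod.swap ` S)"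
    using assms(1) minors_equiv_class[of S] by blast
  have "p permutes {2, 3}" "q permutes {2, 3}"
    using pq by (simp_all add: permutes_pair_iff)
  then have "(p ` R, q ` C) \<in> D" if "(R, C) \<in> D" for R C
    using that image_mono[of R "{2, 3}" p] image_mono[of C "{2, 3}" q]
    by (simp add: D_def permutes_image card_image permutes_inj_on del: image_insert)
  then have "act p q D \<subseteq> D"
    by (auto simp: act_def)
  moreover have "prod.swap ` S \<subseteq> D"
    using assms(2) by (auto simp: D_def subset_iff)
  ultimately show ?thesis using T assms(2) unfolding act_def by blast
qed

lemma class_sum_eq:
  assumes "S \<subseteq> D"
  shows "class_sum A S = (\<Sum>T\<in>(\<Union>p\<in>{id, swap23}. \<Union>q\<in>{id, swap23}. {act p q S, act p q (prod.swap ` S)}). M A T)"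
proof -
  have "{T. T \<subseteq> D \<and> minors_equiv T S} = {T. minors_equiv T S}"
    using minors_equiv_subset_D assms by blast
  then show ?thesis by (simp only: class_sum_def minors_equiv_class)
qed

lemma M_expand:
  assumes "T \<subseteq> D"
  shows "M A T = (if ({}, {}) \<in> T then \<Delta> A ({}, {}) else \<Gamma> A ({}, {}))
    * (if ({2}, {2}) \<in> T then \<Delta> A ({2}, {2}) else \<Gamma> A ({2}, {2}))
    * (if ({2}, {3}) \<in> T then \<Delta> A ({2}, {3}) else \<Gamma> A ({2}, {3}))
    * (if ({3}, {2}) \<in> T then \<Delta> A ({3}, {2}) else \<Gamma> A ({3}, {2}))
    * (if ({3}, {3}) \<in> T then \<Delta> A ({3}, {3}) else \<Gamma> A ({3}, {3}))
    * (if ({2, 3}, {2, 3}) \<in> T then \<Delta> A ({2, 3}, {2, 3}) else \<Gamma> A ({2, 3}, {2, 3}))"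
  unfolding M_eq[OF assms] by (simp add: D_eq mult.assoc)

text \<open>Every \<open>M A T\<close> has exactly one factor, \<Delta> or \<Gamma>, for each member
  of \<open>D\<close>. As both scale by the same \<open>k RC\<close>, the total factor does not
  depend on \<open>T\<close>.\<close>

lemma class_sum_scale:
  assumes "\<And>RC. RC \<in> D \<Longrightarrow> \<Delta> B RC = k RC * \<Delta> A RC" "\<And>RC. RC \<in> D \<Longrightarrow> \<Gamma> B RC = k RC * \<Gamma> A RC"
  shows "class_sum B S = prod k D * class_sum A S"
proof -
  have "M B T = prod k D * M A T" if "T \<subseteq> D" for T
    unfolding M_eq[OF that] prod.distrib[symmetric] using assms by (intro prod.cong) auto
  then show ?thesis by (simp add: class_sum_def sum_distrib_left)
qed

lemma act_insert: "act p q {} = {}" "act p q (insert (R, C) T) = insert (p ` R, q ` C) (act p q T)"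
  by (simp_all add: act_def)

lemma swap_insert: "prod.swap ` {} = {}" "prod.swap ` insert (R, C) T = insert (C, R) (prod.swap ` T)"
  by simp_all

lemma singleton_2_3_neq: "{2} \<noteq> {3 :: nat}" "{3} \<noteq> {2 :: nat}"
  by simp_all

lemma image_id_empty: "id ` X = X" "f ` {} = {}" by simp_all

lemma UN_doubleton: "(\<Union>p\<in>{a, b}. f p) = f a \<union> f b" by simp

lemma mem_D: "({}, {}) \<in> D" "({2}, {2}) \<in> D" "({2}, {3}) \<in> D" "({3}, {2}) \<in> D" "({3}, {3}) \<in> D" "({2, 3}, {2, 3}) \<in> D"
  by (simp_all add: D_eq)

lemma subset_D: "{} \<subseteq> D" "insert a S \<subseteq> D \<longleftrightarrow> a \<in> D \<and> S \<subseteq> D"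
  by simp_all

text \<open>Decides equality of explicit sets of specifications by two inclusions, each reduced to
  membership of the listed pairs; this way coinciding images in an orbit are counted only
  once.\<close>

lemmas spec_set_simps = insert_iff empty_iff prod.inject set_eq_subset[where 'a = minor_spec] insert_subset[where 'a = minor_spec]
   empty_subsetI spec_neq singleton_2_3_neq insert_not_empty empty_not_insert simp_thms refl if_True if_False

text \<open>The symmetries fix \<open>({}, {})\<close> and \<open>({2, 3}, {2, 3})\<close> and act
  on the four singleton pairs as the symmetries of a square. An orbit of subsets of these four is
  determined by size, except that two elements may be adjacent (same row or column, sum
  \<open>p\<close>) or opposite (sum \<open>q\<close>). In \<open>e\<^sub>0\<close>,
  \<open>e\<^sub>1\<close>, \<open>e\<^sub>3\<close>, \<open>e\<^sub>4\<close> the index counts the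
  factors \<open>f\<close>; the others are \<open>g\<close>.\<close>

lemma class_sum_values:
  fixes A :: "real mat"
  defines "f \<equiv> \<lambda>i j. \<Delta> A ({i}, {j})" and "g \<equiv> \<lambda>i j. \<Gamma> A ({i}, {j})"
  defines "e\<^sub>0 \<equiv> g 2 2 * g 2 3 * g 3 2 * g 3 3"
    and "e\<^sub>1 \<equiv> f 2 2 * g 2 3 * g 3 2 * g 3 3 + g 2 2 * f 2 3 * g 3 2 * g 3 3 + g 2 2 * g 2 3 * f 3 2 * g 3 3 + g 2 2 * g 2 3 * g 3 2 * f 3 3"
    and "p \<equiv> f 2 2 * f 2 3 * g 3 2 * g 3 3 + f 2 2 * g 2 3 * f 3 2 * g 3 3 + g 2 2 * f 2 3 * g 3 2 * f 3 3 + g 2 2 * g 2 3 * f 3 2 * f 3 3"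
    and "q \<equiv> f 2 2 * g 2 3 * g 3 2 * f 3 3 + g 2 2 * f 2 3 * f 3 2 * g 3 3"
    and "e\<^sub>3 \<equiv> f 2 2 * f 2 3 * f 3 2 * g 3 3 + f 2 2 * f 2 3 * g 3 2 * f 3 3 + f 2 2 * g 2 3 * f 3 2 * f 3 3 + g 2 2 * f 2 3 * f 3 2 * f 3 3"
    and "e\<^sub>4 \<equiv> f 2 2 * f 2 3 * f 3 2 * f 3 3"
  shows "class_sum A {({}, {}), ({2}, {2}), ({2}, {3}), ({3}, {2}), ({3}, {3}), ({2, 3}, {2, 3})} = \<Delta> A ({}, {}) * e\<^sub>4 * \<Delta> A ({2, 3}, {2, 3})"
    "class_sum A {({}, {}), ({2}, {2}), ({2}, {3}), ({3}, {2}), ({3}, {3})} = \<Delta> A ({}, {}) * e\<^sub>4 * \<Gamma> A ({2, 3}, {2, 3})"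
    "class_sum A {({}, {}), ({2}, {2}), ({2}, {3}), ({3}, {2}), ({2, 3}, {2, 3})} = \<Delta> A ({}, {}) * e\<^sub>3 * \<Delta> A ({2, 3}, {2, 3})"
    "class_sum A {({2}, {2}), ({2}, {3}), ({3}, {2}), ({3}, {3}), ({2, 3}, {2, 3})} = \<Gamma> A ({}, {}) * e\<^sub>4 * \<Delta> A ({2, 3}, {2, 3})"
    "class_sum A {({}, {}), ({2}, {2}), ({2}, {3}), ({3}, {2})} = \<Delta> A ({}, {}) * e\<^sub>3 * \<Gamma> A ({2, 3}, {2, 3})"
    "class_sum A {({}, {}), ({2}, {2}), ({3}, {3}), ({2, 3}, {2, 3})} = \<Delta> A ({}, {}) * q * \<Delta> A ({2, 3}, {2, 3})"
    "class_sum A {({2}, {2}), ({2}, {3}), ({3}, {2}), ({3}, {3})} = \<Gamma> A ({}, {}) * e\<^sub>4 * \<Gamma> A ({2, 3}, {2, 3})"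
    "class_sum A {({}, {}), ({2}, {2}), ({2}, {3})} = \<Delta> A ({}, {}) * p * \<Gamma> A ({2, 3}, {2, 3})"
    "class_sum A {({}, {}), ({2}, {2}), ({3}, {3})} = \<Delta> A ({}, {}) * q * \<Gamma> A ({2, 3}, {2, 3})"
    "class_sum A {({}, {}), ({2}, {2}), ({2, 3}, {2, 3})} = \<Delta> A ({}, {}) * e\<^sub>1 * \<Delta> A ({2, 3}, {2, 3})"
    "class_sum A {({2}, {2}), ({2}, {3}), ({3}, {2})} = \<Gamma> A ({}, {}) * e\<^sub>3 * \<Gamma> A ({2, 3}, {2, 3})"
    "class_sum A {({2}, {2}), ({3}, {3}), ({2, 3}, {2, 3})} = \<Gamma> A ({}, {}) * q * \<Delta> A ({2, 3}, {2, 3})"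
    "class_sum A {({}, {}), ({2}, {2})} = \<Delta> A ({}, {}) * e\<^sub>1 * \<Gamma> A ({2, 3}, {2, 3})"
    "class_sum A {({}, {}), ({2, 3}, {2, 3})} = \<Delta> A ({}, {}) * e\<^sub>0 * \<Delta> A ({2, 3}, {2, 3})"
    "class_sum A {({2}, {2}), ({3}, {3})} = \<Gamma> A ({}, {}) * q * \<Gamma> A ({2, 3}, {2, 3})"
    "class_sum A {({}, {})} = \<Delta> A ({}, {}) * e\<^sub>0 * \<Gamma> A ({2, 3}, {2, 3})"
    "class_sum A {({2}, {2})} = \<Gamma> A ({}, {}) * e\<^sub>1 * \<Gamma> A ({2, 3}, {2, 3})"
    "class_sum A {({2, 3}, {2, 3})} = \<Gamma> A ({}, {}) * e\<^sub>0 * \<Delta> A ({2, 3}, {2, 3})"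
    "class_sum A {} = \<Gamma> A ({}, {}) * e\<^sub>0 * \<Gamma> A ({2, 3}, {2, 3})"
  unfolding e\<^sub>0_def e\<^sub>1_def p_def q_def e\<^sub>3_def e\<^sub>4_def f_def g_def
  by ((subst class_sum_eq, simp only: subset_D mem_D simp_thms,
      simp only: UN_doubleton act_insert swap_insert image_id_empty swap23_image Un_insert_left Un_insert_right Un_empty_left Un_empty_right,
      simp only: sum.insert_if finite.insertI finite.emptyI spec_set_simps sum.empty,
      simp only: M_expand subset_D mem_D spec_set_simps,
      simp only: distrib_left distrib_right add.assoc add_0_right mult_ac add_ac)+,
    simp add: class_sum_eq act_def M_expand)

section \<open>The identity for matrices with all row and column sums 1\<close>

section \<open>The polynomial identity\<close>

text \<open>This is what remains after the factor \<open>t * s\<close> is split off. The hypotheses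
  express \<open>x\<close>, \<open>P\<close>, \<open>m\<close>, \<open>\<delta>\<close> through
  \<open>Q\<close>, \<open>t\<close>, \<open>s\<close>, and the claim becomes an identity of
  polynomials in these three variables.\<close>

lemma two_by_two_identity:
  fixes x \<delta> m t s P Q :: real
  assumes x: "x = 1 - (t + s)" and PQ: "P + Q + t + s = 2"
    and m: "2 * m = P - Q - t + s" and \<delta>: "\<delta> = m - t + s"
  shows "\<delta> * ((t + s) * P * Q - (s * P + t * Q) + (1 + x) * t * s)
    + m * (- (t + s) * P * Q + (2 - x) * (s * P + t * Q) - 3 * (1 + x) * t * s) = 0"
proof -
  have P: "P = 2 - Q - t - s" using PQ by simp
  have m': "m = 1 - Q - t" using m P by simp
  show ?thesis unfolding \<delta> x m' P by (simp add: algebra_simps)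
qed

text \<open>With \<open>f = w - h\<close>, each of the four combinations of the
  \<open>e\<^sub>i\<close>, \<open>p\<close>, \<open>q\<close> becomes a multiple of
  \<open>t * s\<close>, where \<open>t\<close> and \<open>s\<close> are the diagonal and
  off-diagonal entries of \<open>h\<close>.\<close>

lemma doubly_stochastic_minor_identity:
  fixes x a\<^sub>2 a\<^sub>3 b\<^sub>2 b\<^sub>3 w\<^sub>2\<^sub>2 w\<^sub>2\<^sub>3 w\<^sub>3\<^sub>2 w\<^sub>3\<^sub>3 f\<^sub>2\<^sub>2 f\<^sub>2\<^sub>3 f\<^sub>3\<^sub>2 f\<^sub>3\<^sub>3 \<delta> m :: real
  assumes rows: "x + b\<^sub>2 + b\<^sub>3 = 1" "a\<^sub>2 + w\<^sub>2\<^sub>2 + w\<^sub>2\<^sub>3 = 1" "a\<^sub>3 + w\<^sub>3\<^sub>2 + w\<^sub>3\<^sub>3 = 1"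
    and cols: "x + a\<^sub>2 + a\<^sub>3 = 1" "b\<^sub>2 + w\<^sub>2\<^sub>2 + w\<^sub>3\<^sub>2 = 1" "b\<^sub>3 + w\<^sub>2\<^sub>3 + w\<^sub>3\<^sub>3 = 1"
  assumes f: "f\<^sub>2\<^sub>2 = x * w\<^sub>2\<^sub>2 - a\<^sub>2 * b\<^sub>2" "f\<^sub>2\<^sub>3 = x * w\<^sub>2\<^sub>3 - a\<^sub>2 * b\<^sub>3"
      "f\<^sub>3\<^sub>2 = x * w\<^sub>3\<^sub>2 - a\<^sub>3 * b\<^sub>2" "f\<^sub>3\<^sub>3 = x * w\<^sub>3\<^sub>3 - a\<^sub>3 * b\<^sub>3"
    and m: "m = w\<^sub>2\<^sub>2 * w\<^sub>3\<^sub>3 - w\<^sub>2\<^sub>3 * w\<^sub>3\<^sub>2"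
    and \<delta>: "\<delta> = x * m - b\<^sub>2 * (a\<^sub>2 * w\<^sub>3\<^sub>3 - w\<^sub>2\<^sub>3 * a\<^sub>3) + b\<^sub>3 * (a\<^sub>2 * w\<^sub>3\<^sub>2 - w\<^sub>2\<^sub>2 * a\<^sub>3)"
  defines "e\<^sub>0 \<equiv> w\<^sub>2\<^sub>2 * w\<^sub>2\<^sub>3 * w\<^sub>3\<^sub>2 * w\<^sub>3\<^sub>3"
    and "e\<^sub>1 \<equiv> f\<^sub>2\<^sub>2 * w\<^sub>2\<^sub>3 * w\<^sub>3\<^sub>2 * w\<^sub>3\<^sub>3 + w\<^sub>2\<^sub>2 * f\<^sub>2\<^sub>3 * w\<^sub>3\<^sub>2 * w\<^sub>3\<^sub>3
      + w\<^sub>2\<^sub>2 * w\<^sub>2\<^sub>3 * f\<^sub>3\<^sub>2 * w\<^sub>3\<^sub>3 + w\<^sub>2\<^sub>2 * w\<^sub>2\<^sub>3 * w\<^sub>3\<^sub>2 * f\<^sub>3\<^sub>3"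
    and "p \<equiv> f\<^sub>2\<^sub>2 * f\<^sub>2\<^sub>3 * w\<^sub>3\<^sub>2 * w\<^sub>3\<^sub>3 + f\<^sub>2\<^sub>2 * w\<^sub>2\<^sub>3 * f\<^sub>3\<^sub>2 * w\<^sub>3\<^sub>3
      + w\<^sub>2\<^sub>2 * f\<^sub>2\<^sub>3 * w\<^sub>3\<^sub>2 * f\<^sub>3\<^sub>3 + w\<^sub>2\<^sub>2 * w\<^sub>2\<^sub>3 * f\<^sub>3\<^sub>2 * f\<^sub>3\<^sub>3"
    and "q \<equiv> f\<^sub>2\<^sub>2 * w\<^sub>2\<^sub>3 * w\<^sub>3\<^sub>2 * f\<^sub>3\<^sub>3 + w\<^sub>2\<^sub>2 * f\<^sub>2\<^sub>3 * f\<^sub>3\<^sub>2 * w\<^sub>3\<^sub>3"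
    and "e\<^sub>3 \<equiv> f\<^sub>2\<^sub>2 * f\<^sub>2\<^sub>3 * f\<^sub>3\<^sub>2 * w\<^sub>3\<^sub>3 + f\<^sub>2\<^sub>2 * f\<^sub>2\<^sub>3 * w\<^sub>3\<^sub>2 * f\<^sub>3\<^sub>3
      + f\<^sub>2\<^sub>2 * w\<^sub>2\<^sub>3 * f\<^sub>3\<^sub>2 * f\<^sub>3\<^sub>3 + w\<^sub>2\<^sub>2 * f\<^sub>2\<^sub>3 * f\<^sub>3\<^sub>2 * f\<^sub>3\<^sub>3"
    and "e\<^sub>4 \<equiv> f\<^sub>2\<^sub>2 * f\<^sub>2\<^sub>3 * f\<^sub>3\<^sub>2 * f\<^sub>3\<^sub>3"
  shows "\<delta> * (x * (e\<^sub>4 - e\<^sub>3 + q + e\<^sub>1 - 3 * e\<^sub>0) + (e\<^sub>4 - q + e\<^sub>0))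
    + m * (x * (- 3 * e\<^sub>4 + 4 * e\<^sub>3 - 4 * p - 5 * q + 4 * e\<^sub>1 - 3 * e\<^sub>0)
      + (- 3 * e\<^sub>4 + e\<^sub>3 + q - e\<^sub>1 + e\<^sub>0)) = 0"
proof -
  define t where "t = w\<^sub>2\<^sub>2 - f\<^sub>2\<^sub>2"
  define s where "s = w\<^sub>2\<^sub>3 - f\<^sub>2\<^sub>3"
  define P where "P = w\<^sub>2\<^sub>2 + w\<^sub>3\<^sub>3"
  define Q where "Q = w\<^sub>2\<^sub>3 + w\<^sub>3\<^sub>2"
  \<comment> \<open>The 3 by 3 matrices with all row and column sums 1 form a space of dimension
    four; \<open>x\<close>, \<open>a\<^sub>2\<close>, \<open>b\<^sub>2\<close>,
    \<open>w\<^sub>2\<^sub>2\<close> serve as coordinates.\<close>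
  have param: "b\<^sub>3 = 1 - x - b\<^sub>2" "a\<^sub>3 = 1 - x - a\<^sub>2" "w\<^sub>2\<^sub>3 = 1 - a\<^sub>2 - w\<^sub>2\<^sub>2" "w\<^sub>3\<^sub>2 = 1 - b\<^sub>2 - w\<^sub>2\<^sub>2"
    "w\<^sub>3\<^sub>3 = x + a\<^sub>2 + b\<^sub>2 + w\<^sub>2\<^sub>2 - 1"
    using rows cols by simp_all
  \<comment> \<open>The first two equations are definitions; the other two hold because equal row
    and column sums make opposite entries of \<open>h\<close> equal.\<close>
  have f': "f\<^sub>2\<^sub>2 = w\<^sub>2\<^sub>2 - t" "f\<^sub>2\<^sub>3 = w\<^sub>2\<^sub>3 - s" "f\<^sub>3\<^sub>2 = w\<^sub>3\<^sub>2 - s" "f\<^sub>3\<^sub>3 = w\<^sub>3\<^sub>3 - t"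
    unfolding t_def s_def f param by (simp_all add: algebra_simps)
  have x: "x = 1 - (t + s)"
    unfolding t_def s_def f param by (simp add: algebra_simps)
  have PQ: "P + Q + t + s = 2" using x unfolding P_def Q_def param by simp
  \<comment> \<open>The product of the row and column sums of w through
    \<open>w\<^sub>2\<^sub>2\<close> gives \<open>(1 - a\<^sub>2) * (1 - b\<^sub>2) = (1 + x) *
    w\<^sub>2\<^sub>2 - m\<close>, whence \<open>m = P - x - t\<close>. Exchanging the two columns
    gives \<open>- m = Q - x - s\<close>; subtract.\<close>
  have m': "2 * m = P - Q - t + s"
    unfolding m P_def Q_def t_def s_def f param by (simp add: algebra_simps)
  \<comment> \<open>Put u = b adj(w) a, so that \<delta> = xm - u. Expanding h = (1 - x)w + ab gives
    det h = (1 - x)((1 - x)m + u) = (1 - x)(m - \<delta>), while det h = (t - s)(t + s) = (t - s)(1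
    - x). Cancel 1 - x as polynomials.\<close>
  have \<delta>': "\<delta> = m - t + s"
    unfolding \<delta> m t_def s_def f param by (simp add: algebra_simps)
  \<comment> \<open>Let A_k be the sum of the products along the main diagonal with k factors from f
    and the rest from w, and B_k the same for the other diagonal. Then A_1 = 2 A_0 - tP and A_2 =
    A_0 - tP + t^2, similarly B_k with s and Q. All sums are bilinear in A and B, for example
    \<open>e\<^sub>4 - q + e\<^sub>0\<close> is (A_2 - A_0)(B_2 - B_0), and in each combination A_0
    and B_0 cancel.\<close>
  have sums: "e\<^sub>4 - e\<^sub>3 + q + e\<^sub>1 - 3 * e\<^sub>0 = t * s * (t * s - P * Q)"
    "e\<^sub>4 - q + e\<^sub>0 = t * s * (P * Q - (s * P + t * Q) + t * s)"
    "- 3 * e\<^sub>4 + 4 * e\<^sub>3 - 4 * p - 5 * q + 4 * e\<^sub>1 - 3 * e\<^sub>0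
      = t * s * (P * Q - (s * P + t * Q) - 3 * t * s)"
    "- 3 * e\<^sub>4 + e\<^sub>3 + q - e\<^sub>1 + e\<^sub>0 = t * s * (- P * Q + 2 * (s * P + t * Q) - 3 * t * s)"
    unfolding e\<^sub>0_def e\<^sub>1_def p_def q_def e\<^sub>3_def e\<^sub>4_def f' P_def Q_def
    by (simp_all add: algebra_simps)
  have "\<delta> * (x * (e\<^sub>4 - e\<^sub>3 + q + e\<^sub>1 - 3 * e\<^sub>0) + (e\<^sub>4 - q + e\<^sub>0))
    + m * (x * (- 3 * e\<^sub>4 + 4 * e\<^sub>3 - 4 * p - 5 * q + 4 * e\<^sub>1 - 3 * e\<^sub>0)
      + (- 3 * e\<^sub>4 + e\<^sub>3 + q - e\<^sub>1 + e\<^sub>0))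
    = t * s * (\<delta> * ((1 - x) * P * Q - (s * P + t * Q) + (1 + x) * t * s)
    + m * (- (1 - x) * P * Q + (2 - x) * (s * P + t * Q) - 3 * (1 + x) * t * s))"
    unfolding sums by (simp add: algebra_simps)
  also have "\<dots> = 0"
    using two_by_two_identity[OF x PQ m' \<delta>'] x by simp
  finally show ?thesis .
qed

text \<open>The case of a matrix that is already scaled, where \<open>x\<close> is its own corner
  entry, so the variable of the polynomial also occurs inside the minors.\<close>

lemma minor_poly_identity:
  assumes S: "S \<in> carrier_mat 3 3"
    and row: "\<And>i. i < 3 \<Longrightarrow> (\<Sum>j<3. S $$ (i, j)) = 1" and col: "\<And>j. j < 3 \<Longrightarrow> (\<Sum>i<3. S $$ (i, j)) = 1"
    and x: "x = S $$ (0, 0)"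
  shows "class_sum S {({}, {}), ({2}, {2}), ({2}, {3}), ({3}, {2}), ({3}, {3}), ({2, 3}, {2, 3})} * x ^ 6
    + (- 3 * class_sum S {({}, {}), ({2}, {2}), ({2}, {3}), ({3}, {2}), ({3}, {3})}
            - class_sum S {({}, {}), ({2}, {2}), ({2}, {3}), ({3}, {2}), ({2, 3}, {2, 3})}
            + class_sum S {({2}, {2}), ({2}, {3}), ({3}, {2}), ({3}, {3}), ({2, 3}, {2, 3})}) * x ^ 5
    + (4 * class_sum S {({}, {}), ({2}, {2}), ({2}, {3}), ({3}, {2})}
            + class_sum S {({}, {}), ({2}, {2}), ({3}, {3}), ({2, 3}, {2, 3})}
            - 3 * class_sum S {({2}, {2}), ({2}, {3}), ({3}, {2}), ({3}, {3})}) * x ^ 4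
    + (- 4 * class_sum S {({}, {}), ({2}, {2}), ({2}, {3})}
            - 5 * class_sum S {({}, {}), ({2}, {2}), ({3}, {3})}
            + class_sum S {({}, {}), ({2}, {2}), ({2, 3}, {2, 3})}
            + class_sum S {({2}, {2}), ({2}, {3}), ({3}, {2})}
            - class_sum S {({2}, {2}), ({3}, {3}), ({2, 3}, {2, 3})}) * x ^ 3
    + (4 * class_sum S {({}, {}), ({2}, {2})}
            - 3 * class_sum S {({}, {}), ({2, 3}, {2, 3})}
            + class_sum S {({2}, {2}), ({3}, {3})}) * x ^ 2
    + (- 3 * class_sum S {({}, {})} - class_sum S {({2}, {2})} + class_sum S {({2, 3}, {2, 3})}) * x
    + class_sum S {} = 0"
proof -
  define w where "w = (\<lambda>i j. S $$ (i, j))"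
  define f where "f = (\<lambda>i j. w 0 0 * w i j - w i 0 * w 0 j)"
  define m where "m = w 1 1 * w 2 2 - w 1 2 * w 2 1"
  define \<delta> where "\<delta> = x * m - w 0 1 * (w 1 0 * w 2 2 - w 1 2 * w 2 0) + w 0 2 * (w 1 0 * w 2 1 - w 1 1 * w 2 0)"
  note vals = \<Delta>_\<Gamma>_values[OF S]
  have empty: "\<Delta> S ({}, {}) = x" "\<Gamma> S ({}, {}) = x"
    by (simp_all add: vals x)
  have full: "\<Delta> S ({2, 3}, {2, 3}) = \<delta>" "\<Gamma> S ({2, 3}, {2, 3}) = x * m"
    by (simp_all add: vals \<delta>_def m_def w_def x)
  have sums: "w i 0 + w i 1 + w i 2 = 1" "w 0 i + w 1 i + w 2 i = 1" if "i < 3" for i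
    using row[OF that] col[OF that] by (simp_all add: eval_nat_numeral w_def)
  have singles: "\<Delta> S ({2}, {2}) = f 1 1" "\<Delta> S ({2}, {3}) = f 1 2" "\<Delta> S ({3}, {2}) = f 2 1" "\<Delta> S ({3}, {3}) = f 2 2"
    "\<Gamma> S ({2}, {2}) = x * w 1 1" "\<Gamma> S ({2}, {3}) = x * w 1 2" "\<Gamma> S ({3}, {2}) = x * w 2 1" "\<Gamma> S ({3}, {3}) = x * w 2 2"
    by (simp_all add: vals f_def w_def x)
  define e0 where "e0 = w 1 1 * w 1 2 * w 2 1 * w 2 2"
  define e1 where "e1 = f 1 1 * w 1 2 * w 2 1 * w 2 2 + w 1 1 * f 1 2 * w 2 1 * w 2 2
      + w 1 1 * w 1 2 * f 2 1 * w 2 2 + w 1 1 * w 1 2 * w 2 1 * f 2 2"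
  define p where "p = f 1 1 * f 1 2 * w 2 1 * w 2 2 + f 1 1 * w 1 2 * f 2 1 * w 2 2
      + w 1 1 * f 1 2 * w 2 1 * f 2 2 + w 1 1 * w 1 2 * f 2 1 * f 2 2"
  define q where "q = f 1 1 * w 1 2 * w 2 1 * f 2 2 + w 1 1 * f 1 2 * f 2 1 * w 2 2"
  define e3 where "e3 = f 1 1 * f 1 2 * f 2 1 * w 2 2 + f 1 1 * f 1 2 * w 2 1 * f 2 2
      + f 1 1 * w 1 2 * f 2 1 * f 2 2 + w 1 1 * f 1 2 * f 2 1 * f 2 2"
  define e4 where "e4 = f 1 1 * f 1 2 * f 2 1 * f 2 2"
  note e_defs = e0_def e1_def p_def q_def e3_def e4_def
  \<comment> \<open>Each \<Gamma> at a singleton pair is \<open>x\<close> times an entry of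
    \<open>w\<close>, so a product with k factors \<open>f\<close> carries the power 4 - k of
    \<open>x\<close>.\<close>
  have scaled:
    "x * w 1 1 * (x * w 1 2) * (x * w 2 1) * (x * w 2 2) = x ^ 4 * e0"
    "f 1 1 * (x * w 1 2) * (x * w 2 1) * (x * w 2 2) + x * w 1 1 * f 1 2 * (x * w 2 1) * (x * w 2 2)
      + x * w 1 1 * (x * w 1 2) * f 2 1 * (x * w 2 2) + x * w 1 1 * (x * w 1 2) * (x * w 2 1) * f 2 2 = x ^ 3 * e1"
    "f 1 1 * f 1 2 * (x * w 2 1) * (x * w 2 2) + f 1 1 * (x * w 1 2) * f 2 1 * (x * w 2 2)
      + x * w 1 1 * f 1 2 * (x * w 2 1) * f 2 2 + x * w 1 1 * (x * w 1 2) * f 2 1 * f 2 2 = x ^ 2 * p"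
    "f 1 1 * (x * w 1 2) * (x * w 2 1) * f 2 2 + x * w 1 1 * f 1 2 * f 2 1 * (x * w 2 2) = x ^ 2 * q"
    "f 1 1 * f 1 2 * f 2 1 * (x * w 2 2) + f 1 1 * f 1 2 * (x * w 2 1) * f 2 2
      + f 1 1 * (x * w 1 2) * f 2 1 * f 2 2 + x * w 1 1 * f 1 2 * f 2 1 * f 2 2 = x * e3"
    unfolding e_defs by (simp_all add: power_numeral_reduce algebra_simps)
  have "\<delta> * (x * (e4 - e3 + q + e1 - 3 * e0) + (e4 - q + e0))
    + m * (x * (- 3 * e4 + 4 * e3 - 4 * p - 5 * q + 4 * e1 - 3 * e0)
      + (- 3 * e4 + e3 + q - e1 + e0)) = 0"
    unfolding e_defs
  proof (rule doubly_stochastic_minor_identity)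
    show "m = w 1 1 * w 2 2 - w 1 2 * w 2 1" by (rule m_def)
    show "\<delta> = x * m - w 0 1 * (w 1 0 * w 2 2 - w 1 2 * w 2 0) + w 0 2 * (w 1 0 * w 2 1 - w 1 1 * w 2 0)"
      by (rule \<delta>_def)
  qed (use sums[of 0] sums[of 1] sums[of 2] in \<open>simp_all add: f_def x w_def\<close>)
  \<comment> \<open>In the term of degree |T|, the powers of \<open>x\<close> from the variable,
    from the pair \<open>({}, {})\<close> and from the \<Gamma> factors of the other pairs add up to
    7 if \<open>T\<close> contains \<open>({}, {})\<close> and to 6 otherwise. This explains the
    common factor and the shape x(...) + (...) of both coefficients.\<close>
  then have "x ^ 6 * (\<delta> * (x * (e4 - e3 + q + e1 - 3 * e0) + (e4 - q + e0))
    + m * (x * (- 3 * e4 + 4 * e3 - 4 * p - 5 * q + 4 * e1 - 3 * e0)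
      + (- 3 * e4 + e3 + q - e1 + e0))) = 0" by simp
  then show ?thesis
    unfolding class_sum_values empty full singles scaled e4_def[symmetric]
    by (simp add: power_numeral_reduce algebra_simps)
qed

section \<open>Transfer from the Sinkhorn limit back to the given matrix\<close>

theorem theorem2p4:
  fixes A :: "real mat" and x d\<^sub>0 d\<^sub>1 d\<^sub>2 d\<^sub>3 d\<^sub>4 d\<^sub>5 d\<^sub>6 :: real
  assumes "A \<in> carrier_mat 3 3"
    and "\<And>i j. i < 3 \<Longrightarrow> j < 3 \<Longrightarrow> 0 < A $$ (i, j)"
    and "x = Sink A $$ (0, 0)"
    and "d\<^sub>6 = class_sum A {({}, {}), ({2}, {2}), ({2}, {3}), ({3}, {2}), ({3}, {3}), ({2, 3}, {2, 3})}"
    and "d\<^sub>5 = - 3 * class_sum A {({}, {}), ({2}, {2}), ({2}, {3}), ({3}, {2}), ({3}, {3})}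
            - class_sum A {({}, {}), ({2}, {2}), ({2}, {3}), ({3}, {2}), ({2, 3}, {2, 3})}
            + class_sum A {({2}, {2}), ({2}, {3}), ({3}, {2}), ({3}, {3}), ({2, 3}, {2, 3})}"
    and "d\<^sub>4 = 4 * class_sum A {({}, {}), ({2}, {2}), ({2}, {3}), ({3}, {2})}
            + class_sum A {({}, {}), ({2}, {2}), ({3}, {3}), ({2, 3}, {2, 3})}
            - 3 * class_sum A {({2}, {2}), ({2}, {3}), ({3}, {2}), ({3}, {3})}"
    and "d\<^sub>3 = - 4 * class_sum A {({}, {}), ({2}, {2}), ({2}, {3})}
            - 5 * class_sum A {({}, {}), ({2}, {2}), ({3}, {3})}
            + class_sum A {({}, {}), ({2}, {2}), ({2, 3}, {2, 3})}
            + class_sum A {({2}, {2}), ({2}, {3}), ({3}, {2})}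
            - class_sum A {({2}, {2}), ({3}, {3}), ({2, 3}, {2, 3})}"
    and "d\<^sub>2 = 4 * class_sum A {({}, {}), ({2}, {2})}
            - 3 * class_sum A {({}, {}), ({2, 3}, {2, 3})}
            + class_sum A {({2}, {2}), ({3}, {3})}"
    and "d\<^sub>1 = - 3 * class_sum A {({}, {})} - class_sum A {({2}, {2})}
            + class_sum A {({2, 3}, {2, 3})}"
    and "d\<^sub>0 = class_sum A {}"
  shows "d\<^sub>6 * x ^ 6 + d\<^sub>5 * x ^ 5 + d\<^sub>4 * x ^ 4 + d\<^sub>3 * x ^ 3 + d\<^sub>2 * x ^ 2 + d\<^sub>1 * x + d\<^sub>0 = 0"
proof -
  obtain r c where r: "\<And>i. i < 3 \<Longrightarrow> 0 < r i" and c: "\<And>j. j < 3 \<Longrightarrow> 0 < c j"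
    and S: "Sink A = Matrix.mat 3 3 (\<lambda>(i, j). r i * A $$ (i, j) * c j)" and ds: "doubly_stochastic (Sink A)"
    using Sink_3_scaling[OF assms(1,2)] by blast
  \<comment> \<open>By multilinearity of determinants, \<Delta> and \<Gamma> at
    \<open>(R, C)\<close> both collect the factors of row 1, of column 1 and of the rows in
    \<open>R\<close> and columns in \<open>C\<close>, once each. The subtraction of 1 passes from
    1-based specifications to 0-based factors.\<close>
  define k where "k = (\<lambda>(R, C). r 0 * c 0 * (\<Prod>i\<in>R. r (i - 1)) * (\<Prod>j\<in>C. c (j - 1)))"
  have S_carrier: "Sink A \<in> carrier_mat 3 3" by (simp add: S)
  have entry: "Sink A $$ (i, j) = r i * A $$ (i, j) * c j" if "i < 3" "j < 3" for i j
    using that by (simp add: S)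
  note vals = \<Delta>_\<Gamma>_values[OF S_carrier] \<Delta>_\<Gamma>_values[OF assms(1)]
  have \<Delta>: "\<Delta> (Sink A) RC = k RC * \<Delta> A RC" if "RC \<in> D" for RC
    using that by (auto simp: D_eq k_def vals entry algebra_simps)
  have \<Gamma>: "\<Gamma> (Sink A) RC = k RC * \<Gamma> A RC" if "RC \<in> D" for RC
    using that by (auto simp: D_eq k_def vals entry algebra_simps)
  note scale = class_sum_scale[of "Sink A" k A, OF \<Delta> \<Gamma>]
  have "k RC \<noteq> 0" if "RC \<in> D" for RC
    using that r[of 0] c[of 0] r[of 1] c[of 1] r[of 2] c[of 2] by (auto simp: D_eq k_def)
  \<comment> \<open>The relation for \<open>Sink A\<close> is this nonzero constant times the
    relation for \<open>A\<close>, so the constant can be cancelled at the end.\<close>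
  then have K: "prod k D \<noteq> 0" by (simp add: D_eq)
  have "prod k D * (d\<^sub>6 * x ^ 6 + d\<^sub>5 * x ^ 5 + d\<^sub>4 * x ^ 4 + d\<^sub>3 * x ^ 3 + d\<^sub>2 * x ^ 2 + d\<^sub>1 * x + d\<^sub>0) = 0"
    unfolding assms(4-)
    using minor_poly_identity[OF S_carrier _ _ assms(3)] ds
    by (simp add: S[symmetric] scale doubly_stochastic_def S_carrier[THEN carrier_matD(1)] S_carrier[THEN carrier_matD(2)] algebra_simps)
  with K show ?thesis by simp
qed

end
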